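(* Let $g=\begin{bmatrix}A&b\\c^T&d\end{bmatrix}$ and $g_1=\begin{bmatrix}A_1&b_1\\c_1^T&d_1\end{bmatrix}$ be in $G=GL(n+1,\mathbb{R})$. Then $T_g\circ T_{g_1}=T_{g_1g}$; that is, for every open set $U\subset\mathbb{R}^n$ and every map $V$ from $U$ to the cone of positive definite $n\times n$ matrices, $T_g(T_{g_1}(V))(m)=T_{g_1g}(V)(m)$ for all $m\in\mathbb{R}^n$ such that $c^Tm+d>0$, $c_1^Th_g(m)+d_1>0$ and $h_{g_1}(h_g(m))\in U$.
   Context: For $g=\begin{bmatrix}A&b\\c^T&d\end{bmatrix}\in G$ ($A$ an $n\times n$ matrix, $b,c\in\mathbb{R}^n$, $d\in\mathbb{R}$) put $h_g(m)=\frac{Am+b}{c^Tm+d}$ for $c^Tm+d\ne0$, with (invertible) Jacobian matrix $h_g'(m)$. For an open set $U\subset\mathbb{R}^n$, $U_g=\{m: c^Tm+d>0,\ h_g(m)\in U\}$. If $V$ is a map from $U$ to the positive definite matrices, $T_g(V)$ is the map on $U_g$ defined by $$T_g(V)(m)=\frac{1}{c^Tm+d}\,(h'_g(m))^{-1}\,V(h_g(m))\,(h'_g(m)^T)^{-1}.$$ *)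

theory Defs
  imports "HOL-Analysis.Analysis"
begin

text \<open>
  Vectors of \<open>\<real>\<^sup>n\<close> are elements of \<open>real ^ 'n\<close>; a matrix of size \<open>n + 1\<close> is indexed by
  \<open>'n option\<close>, where \<open>Some i\<close> ranges over the first \<open>n\<close> rows or columns and \<open>None\<close> is the
  last one. The group \<open>GL(n+1, \<real>)\<close> consists of the matrices satisfying \<open>invertible\<close>,
  with product \<open>**\<close>.
\<close>

definition block_A :: "real ^ ('n::finite option) ^ ('n option) \<Rightarrow> real ^ 'n ^ 'n" where
  "block_A g = (\<chi> i j. g $ Some i $ Some j)"

definition block_b :: "real ^ ('n::finite option) ^ ('n option) \<Rightarrow> real ^ 'n" where
  "block_b g = (\<chi> i. g $ Some i $ None)"

definition block_c :: "real ^ ('n::finite option) ^ ('n option) \<Rightarrow> real ^ 'n" where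
  "block_c g = (\<chi> j. g $ None $ Some j)"

definition block_d :: "real ^ ('n::finite option) ^ ('n option) \<Rightarrow> real" where
  "block_d g = g $ None $ None"

definition denom :: "real ^ ('n::finite option) ^ ('n option) \<Rightarrow> real ^ 'n \<Rightarrow> real" where
  "denom g m = block_c g \<bullet> m + block_d g"

text \<open>Only meaningful where \<open>denom g m \<noteq> 0\<close>; elsewhere it takes the junk value 0.\<close>

definition homography :: "real ^ ('n::finite option) ^ ('n option) \<Rightarrow> real ^ 'n \<Rightarrow> real ^ 'n" where
  "homography g m = (1 / denom g m) *\<^sub>R (block_A g *v m + block_b g)"

definition homography_jacobian ::
    "real ^ ('n::finite option) ^ ('n option) \<Rightarrow> real ^ 'n \<Rightarrow> real ^ 'n ^ 'n" where
  "homography_jacobian g m = matrix (frechet_derivative (homography g) (at m))"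

definition pos_def_matrices :: "(real ^ 'n ^ 'n::finite) set" where
  "pos_def_matrices = {S. transpose S = S \<and> (\<forall>x. x \<noteq> 0 \<longrightarrow> x \<bullet> (S *v x) > 0)}"

text \<open>The set written \<open>U\<close> with subscript \<open>g\<close>.\<close>

definition pullback_domain ::
    "real ^ ('n::finite option) ^ ('n option) \<Rightarrow> (real ^ 'n) set \<Rightarrow> (real ^ 'n) set" where
  "pullback_domain g U = {m. denom g m > 0 \<and> homography g m \<in> U}"

text \<open>
  A matrix-valued map on a set \<open>U\<close> is a partial map with domain exactly \<open>U\<close>, so that
  the operator \<open>T\<close> carries the domain along: if \<open>dom V = U\<close>, then
  \<open>dom (T g V) = pullback_domain g U\<close>.
\<close>

definition T :: "real ^ ('n::finite option) ^ ('n option) \<Rightarrow>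
    (real ^ 'n \<rightharpoonup> real ^ 'n ^ 'n) \<Rightarrow> (real ^ 'n \<rightharpoonup> real ^ 'n ^ 'n)" where
  "T g V = (\<lambda>m.
     if m \<in> pullback_domain g (dom V)
     then Some ((1 / denom g m) *\<^sub>R
            (matrix_inv (homography_jacobian g m)
              ** the (V (homography g m))
              ** matrix_inv (transpose (homography_jacobian g m))))
     else None)"

lemma dom_T: "dom (T g V) = pullback_domain g (dom V)"
  by (auto simp: T_def split: if_splits)

end

theory Submission
  imports Defs
begin

text \<open>
  Embedding \<open>m\<close> as the column \<open>(m, 1)\<close> of height \<open>n + 1\<close> turns \<open>homography\<close> into a linear
  action: \<open>g (m, 1) = denom g m (homography g m, 1)\<close>. Hence \<open>denom\<close> is a multiplicative cocycle
  and \<open>homography\<close> is multiplicative in \<open>g\<close>; the chain rule makes the Jacobian a cocycle as well,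
  and applying this to \<open>g\<inverse> g\<close> shows that it is invertible.
\<close>

definition homogeneous :: "real ^ 'n \<Rightarrow> real ^ ('n::finite option)" where
  "homogeneous m = (\<chi> i. case i of None \<Rightarrow> 1 | Some j \<Rightarrow> m $ j)"

lemma homogeneous_nth [simp]:
  "homogeneous m $ None = 1" "homogeneous m $ Some j = m $ j"
  by (simp_all add: homogeneous_def)

lemma sum_UNIV_option:
  fixes f :: "'a::finite option \<Rightarrow> 'b::comm_monoid_add"
  shows "sum f UNIV = f None + (\<Sum>j\<in>UNIV. f (Some j))"
  by (simp add: UNIV_option_conv sum.reindex)

lemma matrix_mult_homogeneous_nth:
  "(g *v homogeneous m) $ None = denom g m"
  "(g *v homogeneous m) $ Some i = (block_A g *v m + block_b g) $ i"
  by (simp_all add: matrix_vector_mult_def sum_UNIV_option denom_def block_A_def block_b_def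
      block_c_def block_d_def inner_vec_def)

lemma matrix_mult_homogeneous:
  assumes "denom g m \<noteq> 0"
  shows "g *v homogeneous m = denom g m *\<^sub>R homogeneous (homography g m)"
proof (rule vec_eq_iff[THEN iffD2, rule_format])
  fix i
  show "(g *v homogeneous m) $ i = (denom g m *\<^sub>R homogeneous (homography g m)) $ i"
    using assms by (cases i) (simp_all add: matrix_mult_homogeneous_nth homography_def)
qed

text \<open>Associativity of the matrix action. Its coordinate \<open>None\<close> yields the rule
  for \<open>denom\<close> of a product, its coordinates \<open>Some i\<close> the one for
  \<open>homography\<close>.\<close>

lemma homogeneous_mult:
  assumes "denom g m \<noteq> 0"
  shows "(g1 ** g) *v homogeneous m = denom g m *\<^sub>R (g1 *v homogeneous (homography g m))"
  by (simp add: matrix_vector_mul_assoc[symmetric] matrix_mult_homogeneous[OF assms]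
      matrix_vector_mult_scaleR)

lemma denom_mult:
  assumes "denom g m \<noteq> 0"
  shows "denom (g1 ** g) m = denom g1 (homography g m) * denom g m"
  using arg_cong[OF homogeneous_mult[OF assms], of "\<lambda>v. v $ None" g1]
  by (simp add: matrix_mult_homogeneous_nth(1) mult.commute)

text \<open>The coordinates \<open>Some i\<close> match the numerators up to the factor
  \<open>denom g m\<close>, which cancels by \<open>denom_mult\<close>. Where
  \<open>denom g1 (homography g m)\<close> is 0, the denominator of the product vanishes too and
  both sides are the junk value 0.\<close>

lemma homography_mult:
  assumes "denom g m \<noteq> 0"
  shows "homography (g1 ** g) m = homography g1 (homography g m)"
proof (rule vec_eq_iff[THEN iffD2, rule_format])
  fix i
  show "homography (g1 ** g) m $ i = homography g1 (homography g m) $ i"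
    using arg_cong[OF homogeneous_mult[OF assms], of "\<lambda>v. v $ Some i" g1] assms
    unfolding matrix_mult_homogeneous_nth vector_scaleR_component
    by (simp add: homography_def[of "g1 ** g" m] homography_def[of g1 "homography g m"] denom_mult)
qed

lemma denom_mat_1 [simp]: "denom (mat 1) m = 1"
  using matrix_mult_homogeneous_nth(1)[of "mat 1" m] by simp

lemma homography_mat_1 [simp]: "homography (mat 1) m = m"
  using matrix_mult_homogeneous_nth(2)[of "mat 1" m]
  by (simp add: homography_def vec_eq_iff)

lemma differentiable_homography:
  assumes "denom g m \<noteq> 0"
  shows "homography g differentiable (at m)"
proof -
  have "(\<lambda>x. denom g x) differentiable (at m)"
    unfolding denom_def by (intro derivative_intros) simp
  moreover have "(\<lambda>x. block_A g *v x + block_b g) differentiable (at m)"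
    by (intro derivative_intros linear_imp_differentiable matrix_vector_mul_linear)
  ultimately show ?thesis
    unfolding homography_def using assms
    by (intro differentiable_scaleR differentiable_divide) simp_all
qed

lemma has_derivative_homography:
  assumes "denom g m \<noteq> 0"
  shows "(homography g has_derivative (*v) (homography_jacobian g m)) (at m)"
proof -
  have *: "(homography g has_derivative frechet_derivative (homography g) (at m)) (at m)"
    using differentiable_homography[OF assms] by (simp add: frechet_derivative_works)
  then show ?thesis
    unfolding homography_jacobian_def
    by (simp add: matrix_works has_derivative_linear)
qed

text \<open>Derivatives at a point are unique, so a Jacobian can be found by exhibiting a matrix
  whose action is a derivative.\<close>

lemma homography_jacobian_unique:
  assumes "(homography g has_derivative (*v) J) (at m)"
  shows "homography_jacobian g m = J"
  unfolding homography_jacobian_def frechet_derivative_at[OF assms, symmetric] by simp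

lemma homography_jacobian_mat_1:
  fixes m :: "real ^ 'n::finite"
  shows "homography_jacobian (mat 1) m = mat 1"
proof (rule homography_jacobian_unique)
  have "homography (mat 1) = (\<lambda>x::real ^ 'n. x)" "(*v) (mat 1) = (\<lambda>x::real ^ 'n. x)"
    by (simp_all add: fun_eq_iff)
  then show "(homography (mat 1) has_derivative (*v) (mat 1)) (at m)"
    by simp
qed

lemma homography_jacobian_mult:
  assumes "denom g m \<noteq> 0" "denom g1 (homography g m) \<noteq> 0"
  shows "homography_jacobian (g1 ** g) m =
    homography_jacobian g1 (homography g m) ** homography_jacobian g m"
proof (rule homography_jacobian_unique)
  have "(homography g1 \<circ> homography g has_derivative
      (*v) (homography_jacobian g1 (homography g m)) \<circ> (*v) (homography_jacobian g m)) (at m)"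
    using has_derivative_homography assms by (intro diff_chain_at) auto
  \<comment> \<open>\<open>homography_mult\<close> requires \<open>denom g x\<close> to be nonzero;
    continuity of \<open>denom g\<close> ensures this near \<open>m\<close>, which is enough to
    transfer the derivative.\<close>
  moreover have "\<forall>\<^sub>F x in at m. denom g x \<noteq> 0"
  proof (rule tendsto_imp_eventually_ne[OF _ assms(1)])
    show "(denom g \<longlongrightarrow> denom g m) (at m)"
      unfolding denom_def by (intro tendsto_intros)
  qed
  then have "\<forall>\<^sub>F x in at m. (homography g1 \<circ> homography g) x = homography (g1 ** g) x"
    by eventually_elim (simp add: homography_mult)
  ultimately have "(homography (g1 ** g) has_derivative
      (*v) (homography_jacobian g1 (homography g m)) \<circ> (*v) (homography_jacobian g m)) (at m)"
    \<comment> \<open>The filter \<open>at m\<close> omits \<open>m\<close> itself, so agreement at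
      that point is supplied separately.\<close>
    using homography_mult[OF assms(1)] by (auto intro: has_derivative_transform_eventually)
  then show "(homography (g1 ** g) has_derivative
      (*v) (homography_jacobian g1 (homography g m) ** homography_jacobian g m)) (at m)"
    by (simp add: comp_def matrix_vector_mul_assoc)
qed

lemma invertible_homography_jacobian:
  assumes "invertible g" "denom g m \<noteq> 0"
  shows "invertible (homography_jacobian g m)"
proof -
  obtain g' where g': "g' ** g = mat 1"
    using assms(1) by (auto simp: invertible_def)
  \<comment> \<open>By \<open>denom_mult\<close>, this value times \<open>denom g m\<close> equals
    \<open>denom (mat 1) m = 1\<close>.\<close>
  have "denom g' (homography g m) \<noteq> 0"
    using denom_mult[OF assms(2), of g'] g' by auto
  from homography_jacobian_mult[OF assms(2) this] show ?thesis
    by (auto simp: g' homography_jacobian_mat_1 invertible_left_inverse)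
qed

text \<open>\<open>matrix_inv\<close> is a Hilbert choice, so its value has to be pinned down: if
  \<open>X\<close> is the chosen inverse, then
  \<open>X = (B ** A) ** X = B ** (A ** X) = B\<close>.\<close>

lemma matrix_inv_unique:
  fixes A B :: "'a::semiring_1 ^ 'n ^ 'n"
  assumes "A ** B = mat 1" "B ** A = mat 1"
  shows "matrix_inv A = B"
proof -
  have "A ** matrix_inv A = mat 1 \<and> matrix_inv A ** A = mat 1"
    unfolding matrix_inv_def using assms
    by (intro someI_ex[of "\<lambda>C. A ** C = mat 1 \<and> C ** A = mat 1"]) blast
  then show ?thesis
    using assms by (metis matrix_mul_assoc matrix_mul_lid matrix_mul_rid)
qed

lemma matrix_inv_mult:
  fixes A B :: "'a::semiring_1 ^ 'n ^ 'n"
  assumes "invertible A" "invertible B"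
  shows "matrix_inv (A ** B) = matrix_inv B ** matrix_inv A"
proof -
  obtain A' B' where inverses:
      "A ** A' = mat 1" "A' ** A = mat 1" "B ** B' = mat 1" "B' ** B = mat 1"
    using assms by (auto simp: invertible_def)
  then have "matrix_inv (A ** B) = B' ** A'"
    by (intro matrix_inv_unique) (metis matrix_mul_assoc matrix_mul_rid)+
  then show ?thesis
    using inverses matrix_inv_unique[of A A'] matrix_inv_unique[of B B'] by simp
qed

theorem proposition3p2:
  fixes g g1 :: "real ^ ('n::finite option) ^ ('n option)"
    and U :: "(real ^ 'n) set"
    and V :: "real ^ 'n \<rightharpoonup> real ^ 'n ^ 'n"
    and m :: "real ^ 'n"
  assumes "invertible g" and "invertible g1"
    and "open U" and "dom V = U" and "ran V \<subseteq> pos_def_matrices"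
    and "block_c g \<bullet> m + block_d g > 0"
    and "block_c g1 \<bullet> homography g m + block_d g1 > 0"
    and "homography g1 (homography g m) \<in> U"
  shows "T g (T g1 V) m = T (g1 ** g) V m"
proof -
  have d: "denom g m > 0" and d1: "denom g1 (homography g m) > 0"
    using assms by (simp_all add: denom_def)
  note comp = denom_mult[of g m g1] homography_mult[of g m g1]
  \<comment> \<open>The next three memberships select the \<open>Some\<close> branch in the inner
    \<open>T g1 V\<close>, in the outer \<open>T g\<close> and in
    \<open>T (g1 ** g) V\<close>.\<close>
  have in1: "homography g m \<in> pullback_domain g1 (dom V)"
    using d1 assms by (simp add: pullback_domain_def)
  have in2: "m \<in> pullback_domain g (dom (T g1 V))"
    using d in1 by (simp add: pullback_domain_def dom_T)
  have in3: "m \<in> pullback_domain (g1 ** g) (dom V)"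
    using d d1 assms comp by (simp add: pullback_domain_def)
  define J where "J = homography_jacobian g m"
  define J1 where "J1 = homography_jacobian g1 (homography g m)"
  have inv: "invertible J" "invertible J1"
    unfolding J_def J1_def using assms(1,2) d d1 by (simp_all add: invertible_homography_jacobian)
  have J2: "homography_jacobian (g1 ** g) m = J1 ** J"
    using d d1 by (simp add: homography_jacobian_mult J_def J1_def)
  have invJ2: "matrix_inv (J1 ** J) = matrix_inv J ** matrix_inv J1"
    using inv by (simp add: matrix_inv_mult)
  \<comment> \<open>Transposition and inversion each reverse the product, so the original order of
    the factors returns.\<close>
  have invJ2T: "matrix_inv (transpose (J1 ** J)) =
      matrix_inv (transpose J1) ** matrix_inv (transpose J)"
    using inv by (simp add: matrix_transpose_mul matrix_inv_mult transpose_invertible)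
  \<comment> \<open>Both sides evaluate \<open>V\<close> at the same point by
    \<open>homography_mult\<close>, and the scalar factors agree by \<open>denom_mult\<close>; what
    remains is reassociation.\<close>
  show ?thesis
    using d d1 in1 in2 in3 unfolding T_def
    by (simp add: comp J2 invJ2 invJ2T J_def[symmetric] J1_def[symmetric] matrix_mul_assoc
        scalar_matrix_assoc matrix_scalar_ac mult.commute)
qed

end
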